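(* Let $R, r$ be positive real numbers, and let $\mathcal{A}=\{A_i\}$ be a set of points in the $xy$-plane of $\mathbf{R}^3$ such that the distance between any two distinct points of $\mathcal{A}$ is at least $2r$, and $\mathcal{A}$ is contained in the ball $B(R)$ of radius $R$ centered at the origin $O$. Then for every $\epsilon$ with $0<\epsilon\le 8r^2/R^4$ and $\epsilon<1$, there exists a collection of congruent cylinders $\{C_i\}$, one for each $A_i\in\mathcal{A}$, all of radius $r(1-\epsilon)$, where for each $A_i\neq O$ the axis $l_i$ of $C_i$ is the image, under a rotation around the line $OA_i$, of the line $l_i^{\perp}$ through $A_i$ perpendicular to the $xy$-plane, with the following properties: (a) the axis of $C_i$ passes through $A_i\in\mathcal{A}$; (b) no two (distinct) cylinders of the collection are parallel; (c) every two (distinct) cylinders of the collection have disjoint interiors; (d) $\delta(\mathcal{A},r(1-\epsilon),R)=\delta^{\perp}(\mathcal{A},r(1-\epsilon),R)$, where $\delta(\mathcal{A},r(1-\epsilon),R)$ is the local density of $\{C_i\}$ with respect to $B(R)$ and $\delta^{\perp}(\mathcal{A},r(1-\epsilon),R)$ is the local density with respect to $B(R)$ of the parallel cylinders of radius $r(1-\epsilon)$ with axes $l_i^{\perp}$.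
   Context: For a line $l$ in $\mathbf{R}^3$ and a real $\rho>0$, the (infinite circular) cylinder of axis $l$ and radius $\rho$ is the set of points of $\mathbf{R}^3$ whose distance from $l$ is at most $\rho$. Two cylinders are parallel if their axes are parallel. $B(R)$ denotes the ball of radius $R$ centered at the origin $O$, and $Vol$ denotes volume. For $A_i\in\mathcal{A}$, $l_i^{\perp}$ is the line through $A_i$ perpendicular to the $xy$-plane, and for $\rho>0$, $C_i^{\perp}(\rho)$ is the cylinder of radius $\rho$ with axis $l_i^{\perp}$; one sets $$\delta^{\perp}(\mathcal{A},\rho,R)=\frac{\sum_{i=1}^{|\mathcal{A}|}Vol\left(C_i^{\perp}(\rho)\cap B(R)\right)}{4\pi R^3/3}.$$ For lines $l_i$ through the points $A_i$ (with $l_i$ the image of $l_i^\perp$ under a rotation around $OA_i$ when $A_i\ne O$), $C_i(\rho)$ is the cylinder of radius $\rho$ with axis $l_i$, and $$\delta(\mathcal{A},\rho,R)=\frac{\sum_{i=1}^{|\mathcal{A}|}Vol\left(C_i(\rho)\cap B(R)\right)}{4\pi R^3/3}.$$ *)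

theory Defs
  imports "HOL-Analysis.Analysis"
begin

definition xy_plane :: "(real^3) set" where
  "xy_plane = {p. p $ 3 = 0}"

definition is_line :: "(real^3) set \<Rightarrow> bool" where
  "is_line L \<longleftrightarrow> affine L \<and> aff_dim L = 1"

definition line_through :: "real^3 \<Rightarrow> real^3 \<Rightarrow> (real^3) set" where
  "line_through P Q = affine hull {P, Q}"

definition perp_line :: "real^3 \<Rightarrow> (real^3) set" where
  "perp_line P = {P + t *\<^sub>R axis 3 1 | t. True}"

text \<open>A rotation around a line is an orientation-preserving rigid motion that fixes
  the line pointwise; the identity (angle zero) is included.\<close>

definition rotation_around :: "(real^3) set \<Rightarrow> (real^3 \<Rightarrow> real^3) \<Rightarrow> bool" where
  "rotation_around L f \<longleftrightarrow>
     (\<exists>Q c. rotation_matrix Q \<and> f = (\<lambda>x. Q *v x + c)) \<and> (\<forall>p\<in>L. f p = p)"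

definition cylinder :: "(real^3) set \<Rightarrow> real \<Rightarrow> (real^3) set" where
  "cylinder L \<rho> = {p. infdist p L \<le> \<rho>}"

text \<open>The family \<open>l\<close> assigns to each point of \<open>\<A>\<close> the axis of its cylinder.
  If \<open>\<A>\<close> is infinite the sum is zero by convention; this does not occur for bounded
  sets with a positive minimal distance between points.\<close>

definition local_density ::
    "(real^3 \<Rightarrow> (real^3) set) \<Rightarrow> (real^3) set \<Rightarrow> real \<Rightarrow> real \<Rightarrow> real" where
  "local_density l \<A> \<rho> R =
     (\<Sum>A\<in>\<A>. measure lebesgue (cylinder (l A) \<rho> \<inter> cball 0 R)) / (4 * pi * R ^ 3 / 3)"

end

theory Submission
  imports Defs
begin

text \<open>
  All axes are tilted by one twist: the line through \<open>A\<close> gets the direction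
  \<open>e + \<theta> (e \<times> A)\<close>, where \<open>e\<close> is the unit normal of the \<open>xy\<close>-plane. The point of this line at
  height \<open>t\<close> is the image of \<open>A\<close> under the planar similarity \<open>I + t \<theta> J\<close>, with \<open>J\<close> the quarter turn
  \<open>e \<times> _\<close>, lifted to height \<open>t\<close>. This similarity has ratio \<open>sqrt (1 + t\<^sup>2 \<theta>\<^sup>2) \<ge> 1\<close>, so
  the horizontal sections of the configuration at different heights are rotated, expanded copies
  of \<open>\<A>\<close>, and two axes are never closer than \<open>dist A B\<close> at equal heights.

  Comparing points whose heights differ by \<open>u\<close> moves one of them sideways by at most
  \<open>\<theta> R \<bar>u\<bar>\<close>; the Cauchy-Schwarz inequality then gives that the distance of the two axes is at
  least \<open>dist A B / sqrt (1 + \<theta>\<^sup>2 R\<^sup>2)\<close> (\<open>tilted_lines_dist\<close>).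
  With \<open>\<theta> = sqrt \<epsilon> / R\<close> this exceeds \<open>2 r (1 - \<epsilon>)\<close>, because \<open>(1 + \<epsilon>) (1 - \<epsilon>)\<^sup>2 < 1\<close>; hence even
  the closed cylinders are disjoint. The axes are pairwise non-parallel since the directions have
  equal height component and different horizontal components.

  The horizontal part \<open>\<theta> (e \<times> A)\<close> is orthogonal to \<open>A\<close>, so the tilted line is a rotation of the
  vertical one about \<open>O A\<close> (\<open>tilted_line_rotation\<close>). That rotation fixes \<open>O\<close>, hence preserves both
  the ball and volume, and the local density does not change term by term.
\<close>

section \<open>The twisted family of lines\<close>

definition tilted_dir :: "real \<Rightarrow> real^3 \<Rightarrow> real^3" where
  "tilted_dir \<theta> A = axis 3 1 + \<theta> *\<^sub>R cross3 (axis 3 1) A"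

definition tilted_line :: "real \<Rightarrow> real^3 \<Rightarrow> (real^3) set" where
  "tilted_line \<theta> A = range (\<lambda>t. A + t *\<^sub>R tilted_dir \<theta> A)"

lemma tilted_dir_components:
  "tilted_dir \<theta> A $ 1 = - (\<theta> * A $ 2)" "tilted_dir \<theta> A $ 2 = \<theta> * A $ 1" "tilted_dir \<theta> A $ 3 = 1"
  by (simp_all add: tilted_dir_def cross_components axis_def)

lemma tilted_dir_nonzero: "tilted_dir \<theta> A \<noteq> 0"
  using tilted_dir_components(3)[of \<theta> A] by (metis zero_index zero_neq_one)

lemma tilted_line_zero: "tilted_line \<theta> 0 = perp_line 0"
  by (auto simp: tilted_line_def tilted_dir_def perp_line_def cross3_simps)

lemma base_in_tilted_line: "A \<in> tilted_line \<theta> A"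
  unfolding tilted_line_def by (rule image_eqI[of _ _ 0]) auto

lemma tilted_line_affine_hull: "tilted_line \<theta> A = affine hull {A, A + tilted_dir \<theta> A}"
  by (simp add: affine_hull_2_alt tilted_line_def)

lemma is_line_tilted_line: "is_line (tilted_line \<theta> A)"
  unfolding is_line_def tilted_line_affine_hull by (simp add: tilted_dir_nonzero)

lemma not_parallel_tilted_lines:
  assumes "A \<in> xy_plane" "B \<in> xy_plane" "A \<noteq> B" "\<theta> \<noteq> 0"
  shows "\<not> affine_parallel (tilted_line \<theta> A) (tilted_line \<theta> B)"
proof
  assume "affine_parallel (tilted_line \<theta> A) (tilted_line \<theta> B)"
  then obtain a where a: "tilted_line \<theta> B = (\<lambda>x. a + x) ` tilted_line \<theta> A"
    by (auto simp: affine_parallel_def)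
  have mem: "a + (A + t *\<^sub>R tilted_dir \<theta> A) \<in> tilted_line \<theta> B" for t
    unfolding a by (auto simp: tilted_line_def)
  obtain u v where u: "a + A = B + u *\<^sub>R tilted_dir \<theta> B"
    and v: "a + (A + tilted_dir \<theta> A) = B + v *\<^sub>R tilted_dir \<theta> B"
    using mem[of 0] mem[of 1] by (auto simp: tilted_line_def)
  have "tilted_dir \<theta> A = (a + (A + tilted_dir \<theta> A)) - (a + A)"
    by simp
  also have "\<dots> = (v - u) *\<^sub>R tilted_dir \<theta> B"
    unfolding u v by (simp add: algebra_simps)
  finally have eq: "tilted_dir \<theta> A = (v - u) *\<^sub>R tilted_dir \<theta> B" .
  then have "tilted_dir \<theta> A $ 3 = (v - u) * tilted_dir \<theta> B $ 3"
    by simp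
  then have "v - u = 1"
    by (simp add: tilted_dir_components)
  then have eq: "tilted_dir \<theta> A = tilted_dir \<theta> B"
    using eq by simp
  have "A $ 1 = B $ 1" "A $ 2 = B $ 2"
    using arg_cong[OF eq, of "\<lambda>x. x $ 1"] arg_cong[OF eq, of "\<lambda>x. x $ 2"] \<open>\<theta> \<noteq> 0\<close>
    by (simp_all add: tilted_dir_components)
  with assms show False
    by (simp add: xy_plane_def vec_eq_iff forall_3)
qed

section \<open>Distances between the tilted lines\<close>

text \<open>The similarity \<open>I + s J\<close> of the \<open>xy\<close>-plane has ratio \<open>sqrt (1 + s\<^sup>2)\<close>, as \<open>J\<close> is an isometry
  of the plane and \<open>J w\<close> is orthogonal to \<open>w\<close>.\<close>

lemma norm_twist_ge:
  assumes "w \<in> xy_plane"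
  shows "norm w \<le> norm (w + s *\<^sub>R cross3 (axis 3 1) w)"
proof -
  have "(norm (w + s *\<^sub>R cross3 (axis 3 1) w))\<^sup>2 = (norm w)\<^sup>2 + (norm (s *\<^sub>R cross3 (axis 3 1) w))\<^sup>2"
    by (rule norm_add_Pythagorean) (simp add: orthogonal_def dot_cross_self)
  then have "(norm w)\<^sup>2 \<le> (norm (w + s *\<^sub>R cross3 (axis 3 1) w))\<^sup>2"
    by simp
  then show ?thesis
    by (rule power2_le_imp_le) simp
qed

lemma Cauchy_Schwarz_plane: "(x + y * z)\<^sup>2 \<le> (1 + z\<^sup>2) * (x\<^sup>2 + y\<^sup>2)" for x y z :: real
proof -
  have "(1 + z\<^sup>2) * (x\<^sup>2 + y\<^sup>2) - (x + y * z)\<^sup>2 = (z * x - y)\<^sup>2"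
    by (simp add: power2_eq_square algebra_simps)
  then show ?thesis
    by (metis diff_ge_0_iff_ge zero_le_power2)
qed

lemma tilted_lines_dist:
  assumes "A \<in> xy_plane" "B \<in> xy_plane" "norm A \<le> R"
    and a: "a \<in> tilted_line \<theta> A" and b: "b \<in> tilted_line \<theta> B"
  shows "(dist A B)\<^sup>2 \<le> (1 + \<theta>\<^sup>2 * R\<^sup>2) * (dist a b)\<^sup>2"
proof -
  let ?e = "axis 3 1 :: real^3"
  obtain s t where s: "a = A + s *\<^sub>R tilted_dir \<theta> A" and t: "b = B + t *\<^sub>R tilted_dir \<theta> B"
    using a b by (auto simp: tilted_line_def)
  define w where "w = A - B"
  define u where "u = s - t"
  \<comment> \<open>the horizontal part of \<open>a - b\<close>: twist of \<open>A - B\<close> at height \<open>t\<close>, plus the sideways drift of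
    the first line between the heights \<open>t\<close> and \<open>s\<close>\<close>
  define v where "v = w + (t * \<theta>) *\<^sub>R cross3 ?e w"
  define k where "k = v + (u * \<theta>) *\<^sub>R cross3 ?e A"
  have ab: "a - b = k + u *\<^sub>R ?e"
    unfolding s t k_def v_def w_def u_def tilted_dir_def
    by (simp add: vec_eq_iff forall_3 cross_components axis_def algebra_simps)
  have "w \<in> xy_plane"
    using assms by (simp add: w_def xy_plane_def)
  then have "norm w \<le> norm v"
    unfolding v_def by (rule norm_twist_ge)
  have "k $ 3 = 0"
    using \<open>w \<in> xy_plane\<close> by (simp add: k_def v_def cross_components axis_def xy_plane_def)
  then have "orthogonal k (u *\<^sub>R ?e)"
    by (simp add: orthogonal_def inner_axis)
  then have dist: "(dist a b)\<^sup>2 = (norm k)\<^sup>2 + u\<^sup>2"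
    unfolding dist_norm ab by (simp add: norm_add_Pythagorean)
  have "norm (cross3 ?e A) \<le> R"
  proof -
    have "(norm (cross3 ?e A))\<^sup>2 + (?e \<bullet> A)\<^sup>2 = (norm A)\<^sup>2"
      using norm_cross_dot[of ?e A] by simp
    then have "(norm (cross3 ?e A))\<^sup>2 \<le> (norm A)\<^sup>2"
      using zero_le_power2[of "?e \<bullet> A"] by linarith
    then have "norm (cross3 ?e A) \<le> norm A"
      by (rule power2_le_imp_le) simp
    with \<open>norm A \<le> R\<close> show ?thesis
      by linarith
  qed
  then have drift: "norm ((u * \<theta>) *\<^sub>R cross3 ?e A) \<le> \<bar>u\<bar> * (\<bar>\<theta>\<bar> * R)"
    by (simp add: abs_mult mult.assoc mult_left_mono)
  have "norm v = norm (k - (u * \<theta>) *\<^sub>R cross3 ?e A)"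
    by (simp add: k_def)
  also have "\<dots> \<le> norm k + \<bar>u\<bar> * (\<bar>\<theta>\<bar> * R)"
    using drift norm_triangle_ineq4[of k "(u * \<theta>) *\<^sub>R cross3 ?e A"] by linarith
  finally have "norm w \<le> norm k + \<bar>u\<bar> * (\<bar>\<theta>\<bar> * R)"
    using \<open>norm w \<le> norm v\<close> by linarith
  then have "(norm w)\<^sup>2 \<le> (norm k + \<bar>u\<bar> * (\<bar>\<theta>\<bar> * R))\<^sup>2"
    by (intro power_mono) auto
  also have "\<dots> \<le> (1 + (\<bar>\<theta>\<bar> * R)\<^sup>2) * ((norm k)\<^sup>2 + \<bar>u\<bar>\<^sup>2)"
    by (rule Cauchy_Schwarz_plane)
  finally show ?thesis
    unfolding dist by (simp add: power_mult_distrib dist_norm w_def)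
qed

lemma disjoint_cylinders:
  assumes "closed K" "K \<noteq> {}" "closed L" "L \<noteq> {}"
    and far: "\<And>a b. a \<in> K \<Longrightarrow> b \<in> L \<Longrightarrow> 2 * \<rho> < dist a b"
  shows "cylinder K \<rho> \<inter> cylinder L \<rho> = {}"
proof (rule ccontr)
  assume "cylinder K \<rho> \<inter> cylinder L \<rho> \<noteq> {}"
  then obtain p where p: "infdist p K \<le> \<rho>" "infdist p L \<le> \<rho>"
    by (auto simp: cylinder_def)
  obtain a where a: "a \<in> K" "infdist p K = dist p a"
    using infdist_attains_inf[OF assms(1,2)] by blast
  obtain b where b: "b \<in> L" "infdist p L = dist p b"
    using infdist_attains_inf[OF assms(3,4)] by blast
  have "dist a b \<le> dist p a + dist p b"
    by (metis dist_commute dist_triangle)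
  with far[OF a(1) b(1)] a b p show False
    by linarith
qed

section \<open>Tilting as a rotation\<close>

text \<open>For \<open>p\<^sup>2 + q\<^sup>2 = 1\<close>, this is the rotation by the angle with cosine \<open>c\<close> and sine \<open>s\<close> about the
  horizontal unit vector \<open>u = (p, q, 0)\<close>: with \<open>w = (- q, p, 0)\<close> and \<open>e = (0, 0, 1)\<close> it sends
  \<open>u\<close> to \<open>u\<close>, \<open>w\<close> to \<open>c w - s e\<close>, and \<open>e\<close> to \<open>s w + c e\<close>.\<close>

definition horizontal_rotation :: "real \<Rightarrow> real \<Rightarrow> real \<Rightarrow> real \<Rightarrow> real^3^3" where
  "horizontal_rotation p q c s = vector
     [vector [p\<^sup>2 + c * q\<^sup>2, p * q - c * p * q, - s * q],
      vector [p * q - c * p * q, q\<^sup>2 + c * p\<^sup>2, s * p],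
      vector [s * q, - s * p, c]]"

lemma horizontal_rotation_components:
  "horizontal_rotation p q c s $ 1 $ 1 = p\<^sup>2 + c * q\<^sup>2"
  "horizontal_rotation p q c s $ 1 $ 2 = p * q - c * p * q"
  "horizontal_rotation p q c s $ 1 $ 3 = - s * q"
  "horizontal_rotation p q c s $ 2 $ 1 = p * q - c * p * q"
  "horizontal_rotation p q c s $ 2 $ 2 = q\<^sup>2 + c * p\<^sup>2"
  "horizontal_rotation p q c s $ 2 $ 3 = s * p"
  "horizontal_rotation p q c s $ 3 $ 1 = s * q"
  "horizontal_rotation p q c s $ 3 $ 2 = - s * p"
  "horizontal_rotation p q c s $ 3 $ 3 = c"
  by (simp_all add: horizontal_rotation_def)

lemma rotation_matrix_horizontal_rotation:
  assumes "p\<^sup>2 + q\<^sup>2 = 1" "c\<^sup>2 + s\<^sup>2 = 1"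
  shows "rotation_matrix (horizontal_rotation p q c s)"
proof -
  \<comment> \<open>rewrite rules that eliminate \<open>p\<^sup>2\<close> and \<open>s\<^sup>2\<close> from a monomial, also in front of further factors\<close>
  have red: "p * p = 1 - q * q" "s * s = 1 - c * c"
    using assms by (simp_all add: power2_eq_square)
  then have red': "p * (p * x) = x - q * (q * x)" "s * (s * x) = x - c * (c * x)" for x
    by (simp_all add: left_diff_distrib flip: mult.assoc)
  have "transpose (horizontal_rotation p q c s) ** horizontal_rotation p q c s = mat 1"
    unfolding vec_eq_iff forall_3
    by (simp add: matrix_matrix_mult_def transpose_def sum_3 mat_def horizontal_rotation_components)
      (simp add: power2_eq_square ring_distribs mult_ac red red')
  moreover have "det (horizontal_rotation p q c s) = 1"
    unfolding det_3 horizontal_rotation_components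
    by (simp add: power2_eq_square ring_distribs mult_ac red red')
  ultimately show ?thesis
    by (simp add: rotation_matrix_def orthogonal_matrix)
qed

text \<open>The tilt at \<open>A\<close> has tangent \<open>\<theta> * norm A\<close>, because \<open>e \<times> A\<close> has the length of \<open>A\<close>.\<close>

lemma tilted_line_rotation:
  assumes "A \<in> xy_plane" "A \<noteq> 0"
  obtains Q where "rotation_matrix Q" "Q *v A = A" "(\<lambda>x. Q *v x) ` perp_line A = tilted_line \<theta> A"
proof -
  define n where "n = norm A"
  define p q where "p = A $ 1 / n" and "q = A $ 2 / n"
  define c where "c = 1 / sqrt (1 + (\<theta> * n)\<^sup>2)"
  define s where "s = c * (\<theta> * n)"
  define Q where "Q = horizontal_rotation p q c s"
  have A3: "A $ 3 = 0"
    using assms by (simp add: xy_plane_def)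
  have "n > 0"
    using assms by (simp add: n_def)
  have A12: "A $ 1 = n * p" "A $ 2 = n * q"
    using \<open>n > 0\<close> by (simp_all add: p_def q_def)
  have "n\<^sup>2 = (A $ 1)\<^sup>2 + (A $ 2)\<^sup>2"
    unfolding n_def power2_norm_eq_inner inner_vec_def by (simp add: sum_3 A3 power2_eq_square)
  then have "n\<^sup>2 * (p\<^sup>2 + q\<^sup>2) = n\<^sup>2 * 1"
    by (simp add: A12 power_mult_distrib distrib_left)
  then have pq: "p\<^sup>2 + q\<^sup>2 = 1"
    using \<open>n > 0\<close> by simp
  have pos: "1 + (\<theta> * n)\<^sup>2 > 0"
    by (simp add: add_pos_nonneg)
  then have "c > 0"
    by (simp add: c_def)
  have "c\<^sup>2 * (1 + (\<theta> * n)\<^sup>2) = 1"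
    using pos by (simp add: c_def power_divide)
  then have cs: "c\<^sup>2 + s\<^sup>2 = 1"
    by (simp add: s_def power_mult_distrib distrib_left)
  have "(Q *v A) $ 1 = n * p * (p\<^sup>2 + q\<^sup>2)" "(Q *v A) $ 2 = n * q * (p\<^sup>2 + q\<^sup>2)" "(Q *v A) $ 3 = 0"
    unfolding Q_def
    by (simp_all add: matrix_vector_mult_def sum_3 horizontal_rotation_components A3 A12
        power2_eq_square algebra_simps)
  then have QA: "Q *v A = A"
    unfolding vec_eq_iff forall_3 pq by (simp add: A3 A12)
  have Qe: "Q *v axis 3 1 = c *\<^sub>R tilted_dir \<theta> A"
    unfolding vec_eq_iff forall_3 Q_def
    by (simp add: matrix_vector_mult_def sum_3 horizontal_rotation_components
        tilted_dir_components A12 s_def axis_def)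
  have Q_line: "Q *v (A + t *\<^sub>R axis 3 1) = A + (t * c) *\<^sub>R tilted_dir \<theta> A" for t
    by (simp add: matrix_vector_right_distrib matrix_vector_mult_scaleR QA Qe)
  have "(\<lambda>x. Q *v x) ` perp_line A = tilted_line \<theta> A"
  proof (intro equalityI subsetI)
    fix x assume "x \<in> (\<lambda>x. Q *v x) ` perp_line A"
    then show "x \<in> tilted_line \<theta> A"
      by (auto simp: perp_line_def tilted_line_def Q_line)
  next
    fix x assume "x \<in> tilted_line \<theta> A"
    then obtain t where "x = A + t *\<^sub>R tilted_dir \<theta> A"
      by (auto simp: tilted_line_def)
    then have "x = Q *v (A + (t / c) *\<^sub>R axis 3 1)"
      using \<open>c > 0\<close> by (simp add: Q_line)
    then show "x \<in> (\<lambda>x. Q *v x) ` perp_line A"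
      by (auto simp: perp_line_def)
  qed
  moreover have "rotation_matrix Q"
    unfolding Q_def using pq cs by (rule rotation_matrix_horizontal_rotation)
  ultimately show ?thesis
    using QA that by blast
qed

lemma rotation_around_line_through_origin:
  assumes "rotation_matrix Q" "Q *v A = A"
  shows "rotation_around (line_through 0 A) (\<lambda>x. Q *v x)"
  unfolding rotation_around_def
proof (intro conjI ballI)
  show "\<exists>Q' c. rotation_matrix Q' \<and> (\<lambda>x. Q *v x) = (\<lambda>x. Q' *v x + c)"
    using assms(1) by (intro exI[of _ Q] exI[of _ 0]) simp
  show "Q *v x = x" if "x \<in> line_through 0 A" for x
    using that assms(2)
    by (auto simp: line_through_def affine_hull_2_alt matrix_vector_mult_scaleR)
qed

section \<open>Invariance of the volume inside the ball\<close>

lemma infdist_isometry_image: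
  assumes "\<And>x y. dist (f x) (f y) = dist x y"
  shows "infdist (f x) (f ` S) = infdist x S"
  by (simp add: infdist_def image_image assms)

lemma cylinder_orthogonal_image:
  assumes "orthogonal_transformation f"
  shows "cylinder (f ` L) \<rho> = f ` cylinder L \<rho>"
proof -
  have inf: "infdist (f x) (f ` L) = infdist x L" for x
    using assms by (intro infdist_isometry_image) (auto simp: orthogonal_transformation_isometry)
  have "y \<in> f ` cylinder L \<rho>" if "y \<in> cylinder (f ` L) \<rho>" for y
  proof -
    obtain x where "y = f x"
      using orthogonal_transformation_surj[OF assms] by (meson surjD)
    with that show ?thesis
      by (auto simp: cylinder_def inf)
  qed
  then show ?thesis
    by (auto simp: cylinder_def inf)
qed

lemma measure_cylinder_orthogonal_image:
  fixes f :: "real^3 \<Rightarrow> real^3"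
  assumes "orthogonal_transformation f"
  shows "measure lebesgue (cylinder (f ` L) \<rho> \<inter> cball 0 R)
       = measure lebesgue (cylinder L \<rho> \<inter> cball 0 R)"
proof -
  have "f 0 = 0"
    using assms by (simp add: linear_0 orthogonal_transformation_linear)
  then have "cball 0 R = f ` cball 0 R"
    using image_orthogonal_transformation_cball[OF assms, of 0 R] by simp
  then have "cylinder (f ` L) \<rho> \<inter> cball 0 R = f ` (cylinder L \<rho> \<inter> cball 0 R)"
    using cylinder_orthogonal_image[OF assms] orthogonal_transformation_inj[OF assms]
    by (metis image_Int)
  moreover have "closed (cylinder L \<rho>)"
    unfolding cylinder_def by (intro closed_Collect_le continuous_intros)
  then have "cylinder L \<rho> \<inter> cball 0 R \<in> lmeasurable"
    by (intro lmeasurable_compact closed_Int_compact compact_cball)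
  ultimately show ?thesis
    using measure_orthogonal_image[OF assms] by metis
qed

section \<open>Non-parallel cylinders of the same local density\<close>

theorem theorem2p2:
  fixes R r \<epsilon> :: real and \<A> :: "(real^3) set"
  assumes "R > 0" and "r > 0"
    and "\<A> \<subseteq> xy_plane"
    and "\<And>A B. A \<in> \<A> \<Longrightarrow> B \<in> \<A> \<Longrightarrow> A \<noteq> B \<Longrightarrow> dist A B \<ge> 2 * r"
    and "\<A> \<subseteq> cball 0 R"
    and "0 < \<epsilon>" and "\<epsilon> \<le> 8 * r ^ 2 / R ^ 4" and "\<epsilon> < 1"
  shows "\<exists>l :: real^3 \<Rightarrow> (real^3) set.
      (\<forall>A\<in>\<A>. is_line (l A)) \<and>
      (\<forall>A\<in>\<A>. A \<noteq> 0 \<longrightarrow>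
         (\<exists>f. rotation_around (line_through 0 A) f \<and> l A = f ` perp_line A)) \<and>
      (\<forall>A\<in>\<A>. A \<in> l A) \<and>
      (\<forall>A\<in>\<A>. \<forall>B\<in>\<A>. A \<noteq> B \<longrightarrow> \<not> affine_parallel (l A) (l B)) \<and>
      (\<forall>A\<in>\<A>. \<forall>B\<in>\<A>. A \<noteq> B \<longrightarrow>
         interior (cylinder (l A) (r * (1 - \<epsilon>))) \<inter>
         interior (cylinder (l B) (r * (1 - \<epsilon>))) = {}) \<and>
      local_density l \<A> (r * (1 - \<epsilon>)) R = local_density perp_line \<A> (r * (1 - \<epsilon>)) R"
proof -
  define \<theta> where "\<theta> = sqrt \<epsilon> / R"
  define \<rho> where "\<rho> = r * (1 - \<epsilon>)"
  have "\<theta> > 0" and tilt: "\<theta>\<^sup>2 * R\<^sup>2 = \<epsilon>"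
    using \<open>R > 0\<close> \<open>0 < \<epsilon>\<close> by (simp_all add: \<theta>_def power_divide)
  have disjoint: "cylinder (tilted_line \<theta> A) \<rho> \<inter> cylinder (tilted_line \<theta> B) \<rho> = {}"
    if "A \<in> \<A>" "B \<in> \<A>" "A \<noteq> B" for A B
  proof (rule disjoint_cylinders)
    fix a b assume "a \<in> tilted_line \<theta> A" "b \<in> tilted_line \<theta> B"
    moreover have "A \<in> xy_plane" "B \<in> xy_plane" "norm A \<le> R"
      using that assms(3,5) by auto
    ultimately have "(dist A B)\<^sup>2 \<le> (1 + \<epsilon>) * (dist a b)\<^sup>2"
      using tilted_lines_dist tilt by metis
    moreover have "(2 * r)\<^sup>2 \<le> (dist A B)\<^sup>2"
      using assms(4)[OF that] \<open>r > 0\<close> by (intro power_mono) linarith+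
    ultimately have le: "(2 * r)\<^sup>2 \<le> (1 + \<epsilon>) * (dist a b)\<^sup>2"
      by linarith
    have "(1 + \<epsilon>) * (1 - \<epsilon>)\<^sup>2 = (1 - \<epsilon>\<^sup>2) * (1 - \<epsilon>)"
      by (simp add: power2_eq_square algebra_simps)
    also have "\<dots> < 1 * 1"
      using \<open>0 < \<epsilon>\<close> \<open>\<epsilon> < 1\<close> by (intro mult_strict_mono) (auto simp: power_le_one)
    finally have less: "(1 + \<epsilon>) * (1 - \<epsilon>)\<^sup>2 < 1"
      by simp
    have "(1 + \<epsilon>) * (2 * \<rho>)\<^sup>2 = (2 * r)\<^sup>2 * ((1 + \<epsilon>) * (1 - \<epsilon>)\<^sup>2)"
      by (simp add: \<rho>_def power_mult_distrib)
    also have "\<dots> < (2 * r)\<^sup>2 * 1"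
      using less \<open>r > 0\<close> by (intro mult_strict_left_mono) auto
    finally have "(1 + \<epsilon>) * (2 * \<rho>)\<^sup>2 < (2 * r)\<^sup>2"
      by simp
    with le have "(1 + \<epsilon>) * (2 * \<rho>)\<^sup>2 < (1 + \<epsilon>) * (dist a b)\<^sup>2"
      by linarith
    then have "(2 * \<rho>)\<^sup>2 < (dist a b)\<^sup>2"
      using \<open>0 < \<epsilon>\<close> by simp
    then show "2 * \<rho> < dist a b"
      by (rule power2_less_imp_less) simp
  qed (use base_in_tilted_line in \<open>auto simp: tilted_line_affine_hull\<close>)

  have rotation: "\<exists>f. rotation_around (line_through 0 A) f \<and> tilted_line \<theta> A = f ` perp_line A"
    if A: "A \<in> \<A>" "A \<noteq> 0" for A
  proof -
    obtain Q where "rotation_matrix Q" "Q *v A = A" "(\<lambda>x. Q *v x) ` perp_line A = tilted_line \<theta> A"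
      using tilted_line_rotation A assms(3) by blast
    then show ?thesis
      using rotation_around_line_through_origin by metis
  qed

  have volume: "measure lebesgue (cylinder (tilted_line \<theta> A) \<rho> \<inter> cball 0 R)
      = measure lebesgue (cylinder (perp_line A) \<rho> \<inter> cball 0 R)" if A: "A \<in> \<A>" for A
  proof (cases "A = 0")
    case True
    then show ?thesis
      by (simp add: tilted_line_zero)
  next
    case False
    then obtain Q where "rotation_matrix Q"
      and img: "(\<lambda>x. Q *v x) ` perp_line A = tilted_line \<theta> A"
      using tilted_line_rotation A assms(3) by blast
    then have "orthogonal_transformation (\<lambda>x. Q *v x)"
      by (simp add: rotation_matrix_def orthogonal_transformation_matrix)
    then show ?thesis
      unfolding img[symmetric] by (rule measure_cylinder_orthogonal_image)
  qed

  show ?thesis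
    unfolding \<rho>_def[symmetric]
  proof (intro exI[of _ "tilted_line \<theta>"] conjI ballI impI)
    fix A B assume AB: "A \<in> \<A>" "B \<in> \<A>" "A \<noteq> B"
    show "\<not> affine_parallel (tilted_line \<theta> A) (tilted_line \<theta> B)"
      using AB assms(3) \<open>\<theta> > 0\<close> by (intro not_parallel_tilted_lines) auto
    show "interior (cylinder (tilted_line \<theta> A) \<rho>) \<inter> interior (cylinder (tilted_line \<theta> B) \<rho>) = {}"
      using disjoint[OF AB] interior_subset by blast
  next
    show "local_density (tilted_line \<theta>) \<A> \<rho> R = local_density perp_line \<A> \<rho> R"
      using volume by (simp add: local_density_def)
  next
    show "is_line (tilted_line \<theta> A)" for A
      by (rule is_line_tilted_line)
    show "\<exists>f. rotation_around (line_through 0 A) f \<and> tilted_line \<theta> A = f ` perp_line A"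
      if "A \<in> \<A>" "A \<noteq> 0" for A
      using that by (rule rotation)
    show "A \<in> tilted_line \<theta> A" for A
      by (rule base_in_tilted_line)
  qed
qed

end
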